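(* For every integer $n\ge 1$, the number of frustrated parking functions of length $n$ is $(2n-1)!! = 1\cdot 3\cdot 5\cdots(2n-1)$.
   Context: Let $n\ge 1$ and $[n]=\{1,2,\dots,n\}$. There are $n$ cars and $n$ parking spots numbered $1,\dots,n$, all initially empty. Given a preference sequence $(a_1,\dots,a_n)\in[n]^n$, cars $1,2,\dots,n$ enter in this order. If spot $a_i$ is unoccupied when car $i$ enters, car $i$ parks in spot $a_i$. Otherwise car $i$ parks in the largest-numbered unoccupied spot greater than $a_i$, if such a spot exists; if none exists, car $i$ cannot park. The sequence $(a_1,\dots,a_n)$ is a frustrated parking function of length $n$ if all $n$ cars can park under this rule. *)

theory Defs
  imports Main
begin

(* The spot taken by a car with preference a when the spots in S are occupied;
   None if the car cannot park. *)
definition parking_spot :: "nat \<Rightarrow> nat set \<Rightarrow> nat \<Rightarrow> nat option" where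
  "parking_spot n S a =
    (if a \<notin> S then Some a
     else if \<exists>j\<in>{1..n}. j \<notin> S \<and> a < j then Some (Max {j\<in>{1..n}. j \<notin> S \<and> a < j})
     else None)"

(* Outcomes of the cars in order of entry, starting from occupied spots S;
   a car that cannot park leaves the occupied spots unchanged. *)
fun parking_outcomes :: "nat \<Rightarrow> nat set \<Rightarrow> nat list \<Rightarrow> nat option list" where
  "parking_outcomes n S [] = []"
| "parking_outcomes n S (a # as) =
    parking_spot n S a # parking_outcomes n (S \<union> set_option (parking_spot n S a)) as"

definition frustrated_parking_function :: "nat \<Rightarrow> nat list \<Rightarrow> bool" where
  "frustrated_parking_function n as \<longleftrightarrow>
    length as = n \<and> set as \<subseteq> {1..n} \<and> None \<notin> set (parking_outcomes n {} as)"

end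

theory Submission
  imports Defs
begin

text \<open>
  The count becomes tractable once it is made for all partially filled streets at once. Suppose
  that exactly the spots in \<open>U \<subseteq> {1..n}\<close> are still empty, and ask how many preference lists of
  length \<open>card U\<close> fill them. A displaced car always ends in the largest empty spot of the whole
  street: the largest empty spot beyond its preference is \<open>Max U\<close> whenever it exists. Hence a
  spot \<open>s \<in> U\<close> other than \<open>Max U\<close> is taken only by a car that prefers \<open>s\<close>, while \<open>Max U\<close> is
  also taken by a car that prefers one of the occupied spots below it. Only the position of
  \<open>Max U\<close> and the size of \<open>U\<close> matter for these numbers, so the count is a function of \<open>U\<close> alone
  (\<open>fillings\<close>, justified by \<open>card_completions\<close>).

  For a single \<open>U\<close> this count has no evident closed form, but its sum \<open>A(k, n)\<close> over all
  \<open>k\<close>-subsets of \<open>{1..n}\<close> does. Sets without \<open>n\<close> contribute \<open>A(k, n - 1)\<close>. For a set containing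
  \<open>n\<close>, look at the first car: either it takes \<open>n\<close>, which \<open>n - k + 1\<close> preferences achieve, or it
  takes another spot \<open>s\<close>, and then the remaining set \<open>V\<close> contains \<open>n\<close> and \<open>s\<close> is any of the
  \<open>n - k + 1\<close> elements of its complement. Both cases carry the same factor, and together the
  remaining sets range over all \<open>(k - 1)\<close>-subsets, so that
  \<open>A(k, n) = A(k, n - 1) + (n - k + 1) A(k - 1, n)\<close>.
  This is the recurrence of the coefficients of the Bessel polynomials,
  \<open>A(k, n) = (n + k)! / (2^k k! (n - k)!)\<close> for \<open>k \<le> n\<close>, and \<open>A(n, n) = (2n)! / (2^n n!) = (2n - 1)!!\<close>
  is the number of frustrated parking functions.
\<close>

section \<open>Filling a given set of empty spots\<close>

lemma parking_spot_eq_Max: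
  assumes U: "U \<subseteq> {1..n}" and a: "a \<in> {1..n}"
  shows "parking_spot n ({1..n} - U) a =
    (if a \<in> U then Some a else if a < Max U \<and> U \<noteq> {} then Some (Max U) else None)"
proof -
  have fin: "finite U" using U finite_subset by blast
  have set_eq: "{j \<in> {1..n}. j \<notin> {1..n} - U \<and> a < j} = {j \<in> U. a < j}"
    using U by auto
  have ex_iff: "(\<exists>j\<in>{1..n}. j \<notin> {1..n} - U \<and> a < j) \<longleftrightarrow> a < Max U \<and> U \<noteq> {}"
    using U fin Max_gr_iff[of U a] by auto
  have "Max {j \<in> U. a < j} = Max U" if "a < Max U" "U \<noteq> {}"
    using that fin by (intro Max_eqI) auto
  then show ?thesis
    using a unfolding parking_spot_def ex_iff set_eq by auto
qed

text \<open>
  When \<open>s = Max U\<close>, every spot up to \<open>s\<close> other than the empty ones below \<open>s\<close> leads to \<open>s\<close>; the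
  elements of \<open>U - {s}\<close> are exactly these empty spots.
\<close>

definition preferences_for :: "nat set \<Rightarrow> nat \<Rightarrow> nat set" where
  "preferences_for U s = (if s = Max U then {1..s} - (U - {s}) else {s})"

lemma parking_spot_eq_Some_iff:
  assumes "U \<subseteq> {1..n}" "a \<in> {1..n}"
  shows "parking_spot n ({1..n} - U) a = Some s \<longleftrightarrow> s \<in> U \<and> a \<in> preferences_for U s"
proof -
  have "finite U" using assms finite_subset by blast
  then have "Max U \<in> U" if "U \<noteq> {}" using that by simp
  then show ?thesis
    using assms(2) unfolding parking_spot_eq_Max[OF assms] preferences_for_def
    by (auto simp: less_le)
qed

lemma preferences_for_subset:
  "U \<subseteq> {1..n} \<Longrightarrow> s \<in> U \<Longrightarrow> preferences_for U s \<subseteq> {1..n}"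
  by (auto simp: preferences_for_def)

lemma card_preferences_for:
  assumes U: "U \<subseteq> {1..n}" and s: "s \<in> U"
  shows "card (preferences_for U s) = (if s = Max U then Suc s - card U else 1)"
proof (cases "s = Max U")
  case True
  have fin: "finite U" using U finite_subset by blast
  have sub: "U - {s} \<subseteq> {1..s}" using U True fin by auto
  have "card ({1..s} - (U - {s})) = s - card (U - {s})"
    using fin sub by (simp add: card_Diff_subset)
  also have "\<dots> = Suc s - card U"
    using card_Suc_Diff1[OF fin s] by simp
  finally show ?thesis using True by (simp add: preferences_for_def)
qed (simp add: preferences_for_def)

definition completions :: "nat \<Rightarrow> nat set \<Rightarrow> nat list set" where
  "completions n U = {as. length as = card U \<and> set as \<subseteq> {1..n} \<and>
     None \<notin> set (parking_outcomes n ({1..n} - U) as)}"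

lemma finite_completions: "finite (completions n U)"
  by (rule finite_subset[OF _ finite_lists_length_eq[of "{1..n}" "card U"]])
    (auto simp: completions_def)

text \<open>
  A completion is the choice of the spot \<open>s\<close> that the first car takes, a preference that sends
  it there, and a completion of \<open>U - {s}\<close>.
\<close>

lemma completions_eq_image:
  assumes U: "U \<subseteq> {1..n}" and ne: "U \<noteq> {}"
  shows "completions n U =
    (\<lambda>(s, a, as). a # as) ` (SIGMA s:U. preferences_for U s \<times> completions n (U - {s}))"
proof -
  have fin: "finite U" using U finite_subset by blast
  have rest: "{1..n} - U \<union> {s} = {1..n} - (U - {s})" if "s \<in> U" for s
    using that U by auto
  have Suc_length_iff: "Suc (length as) = card U \<longleftrightarrow> length as = card (U - {s})"
    if "s \<in> U" for s and as :: "nat list"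
    using card_Suc_Diff1[OF fin that] by linarith
  have Cons_iff: "a # as \<in> completions n U \<longleftrightarrow>
      (\<exists>s\<in>U. a \<in> preferences_for U s \<and> as \<in> completions n (U - {s}))" for a as
  proof
    assume *: "a # as \<in> completions n U"
    then have a: "a \<in> {1..n}" by (auto simp: completions_def)
    from * obtain s where s: "parking_spot n ({1..n} - U) a = Some s"
      by (cases "parking_spot n ({1..n} - U) a") (auto simp: completions_def)
    then have "s \<in> U" "a \<in> preferences_for U s"
      using parking_spot_eq_Some_iff[OF U a] by auto
    then show "\<exists>s\<in>U. a \<in> preferences_for U s \<and> as \<in> completions n (U - {s})"
      using * s rest[of s] Suc_length_iff[of s as] by (auto simp: completions_def)
  next
    assume "\<exists>s\<in>U. a \<in> preferences_for U s \<and> as \<in> completions n (U - {s})"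
    then obtain s where s: "s \<in> U" "a \<in> preferences_for U s" "as \<in> completions n (U - {s})"
      by blast
    have a: "a \<in> {1..n}" using preferences_for_subset[OF U] s by blast
    have "parking_spot n ({1..n} - U) a = Some s"
      using parking_spot_eq_Some_iff[OF U a] s by auto
    then show "a # as \<in> completions n U"
      using s a rest[of s] Suc_length_iff[of s as] by (auto simp: completions_def)
  qed
  have "[] \<notin> completions n U" using fin ne by (auto simp: completions_def)
  then have "\<exists>a as. x = a # as" if "x \<in> completions n U" for x
    using that by (cases x) auto
  then show ?thesis
    using Cons_iff by (fastforce simp: image_iff)
qed

lemma card_completions_step:
  assumes U: "U \<subseteq> {1..n}" and ne: "U \<noteq> {}"
  shows "card (completions n U) =
    (\<Sum>s\<in>U. card (preferences_for U s) * card (completions n (U - {s})))"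
proof -
  have fin: "finite U" using U finite_subset by blast
  have fin_pref: "finite (preferences_for U s)" for s
    by (simp add: preferences_for_def)
  have "inj_on (\<lambda>(s, a, as). a # as)
      (SIGMA s:U. preferences_for U s \<times> completions n (U - {s}))"
  proof (rule inj_onI, clarsimp)
    fix s t a
    assume "s \<in> U" "t \<in> U" "a \<in> preferences_for U s" "a \<in> preferences_for U t"
    moreover have "a \<in> {1..n}"
      using preferences_for_subset[OF U] \<open>s \<in> U\<close> \<open>a \<in> preferences_for U s\<close> by blast
    ultimately have "parking_spot n ({1..n} - U) a = Some s"
      "parking_spot n ({1..n} - U) a = Some t"
      using parking_spot_eq_Some_iff[OF U] by auto
    then show "s = t" by simp
  qed
  then show ?thesis
    using fin fin_pref finite_completions
    by (simp add: completions_eq_image[OF U ne] card_image card_cartesian_product)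
qed

text \<open>
  The first argument stands for \<open>card U\<close> and drives the recursion; with \<open>card U = k + 1\<close>, the
  number of preferences that lead to \<open>s = Max U\<close> is \<open>s - k\<close>. The length of the street does not
  occur, so that a set without \<open>n\<close> counts the same in the streets of length \<open>n\<close> and \<open>n - 1\<close>.
\<close>

primrec fillings :: "nat \<Rightarrow> nat set \<Rightarrow> nat" where
  "fillings 0 U = 1"
| "fillings (Suc k) U =
    (\<Sum>s\<in>U. (if s = Max U then s - k else 1) * fillings k (U - {s}))"

lemma card_completions:
  assumes "U \<subseteq> {1..n}" "card U = k"
  shows "card (completions n U) = fillings k U"
  using assms
proof (induction k arbitrary: U)
  case 0
  then have "U = {}" using finite_subset by fastforce
  then have "completions n U = {[]}" by (auto simp: completions_def)
  then show ?case by simp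
next
  case (Suc k)
  then have "U \<noteq> {}" by auto
  have "card (completions n (U - {s})) = fillings k (U - {s})" if "s \<in> U" for s
    using Suc.prems that by (intro Suc.IH) auto
  then show ?case
    unfolding card_completions_step[OF Suc.prems(1) \<open>U \<noteq> {}\<close>] fillings.simps
    using Suc.prems by (intro sum.cong) (auto simp: card_preferences_for)
qed

section \<open>Summing over all sets of empty spots of a given size\<close>

definition k_subsets :: "nat \<Rightarrow> nat \<Rightarrow> nat set set" where
  "k_subsets k n = {U. U \<subseteq> {1..n} \<and> card U = k}"

definition total_fillings :: "nat \<Rightarrow> nat \<Rightarrow> nat" where
  "total_fillings k n = (\<Sum>U\<in>k_subsets k n. fillings k U)"

lemma finite_k_subsets: "finite (k_subsets k n)"
  by (rule finite_subset[of _ "Pow {1..n}"]) (auto simp: k_subsets_def)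

lemma finite_k_subset: "U \<in> k_subsets k n \<Longrightarrow> finite U"
  by (rule finite_subset[of _ "{1..n}"]) (auto simp: k_subsets_def)

lemma k_subsets_empty:
  assumes "n < k"
  shows "k_subsets k n = {}"
proof -
  have "U \<notin> k_subsets k n" for U
    using card_mono[of "{1..n}" U] assms by (auto simp: k_subsets_def)
  then show ?thesis by blast
qed

lemma k_subsets_0: "k_subsets 0 n = {{}}"
proof -
  have "U = {}" if "U \<in> k_subsets 0 n" for U
    using finite_k_subset[OF that] that by (simp add: k_subsets_def)
  moreover have "{} \<in> k_subsets 0 n" by (simp add: k_subsets_def)
  ultimately show ?thesis by blast
qed

lemma k_subsets_full: "k_subsets n n = {{1..n}}"
proof -
  have "U = {1..n}" if "U \<in> k_subsets n n" for U
    using that card_subset_eq[of "{1..n}" U] by (simp add: k_subsets_def)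
  moreover have "{1..n} \<in> k_subsets n n" by (simp add: k_subsets_def)
  ultimately show ?thesis by blast
qed

lemma k_subsets_Suc_right:
  "k_subsets k (Suc n) = k_subsets k n \<union> {U \<in> k_subsets k (Suc n). Suc n \<in> U}"
proof -
  have "U \<subseteq> {1..Suc n} \<longleftrightarrow> U \<subseteq> {1..n} \<or> U \<subseteq> {1..Suc n} \<and> Suc n \<in> U" for U
    unfolding subset_iff atLeastAtMost_iff by (metis le_SucE le_SucI)
  then show ?thesis unfolding k_subsets_def by blast
qed

lemma sum_k_subsets_Suc_right:
  "(\<Sum>U\<in>k_subsets k (Suc n). f U) =
    (\<Sum>U\<in>k_subsets k n. f U) + (\<Sum>U\<in>{U \<in> k_subsets k (Suc n). Suc n \<in> U}. f U)"
proof -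
  have "k_subsets k n \<inter> {U \<in> k_subsets k (Suc n). Suc n \<in> U} = {}"
    by (auto simp: k_subsets_def)
  then show ?thesis
    by (subst k_subsets_Suc_right, subst sum.union_disjoint) (auto simp: finite_k_subsets)
qed

text \<open>
  The case in which the first car takes the last spot: the remaining empty spots form an
  arbitrary \<open>k\<close>-subset of \<open>{1..n}\<close>.
\<close>

lemma sum_remove_last_spot:
  "(\<Sum>U\<in>{U \<in> k_subsets (Suc k) (Suc n). Suc n \<in> U}. f (U - {Suc n})) =
    (\<Sum>V\<in>k_subsets k n. f V)"
proof (rule sum.reindex_bij_witness[where i = "insert (Suc n)" and j = "\<lambda>U. U - {Suc n}"])
  fix U assume U: "U \<in> {U \<in> k_subsets (Suc k) (Suc n). Suc n \<in> U}"
  then have "finite U" using finite_k_subset by blast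
  with U show "U - {Suc n} \<in> k_subsets k n"
    by (auto simp: k_subsets_def atLeastAtMostSuc_conv)
next
  fix V assume V: "V \<in> k_subsets k n"
  then have "finite V" "Suc n \<notin> V"
    using finite_k_subset[OF V] by (auto simp: k_subsets_def)
  with V show "insert (Suc n) V \<in> {U \<in> k_subsets (Suc k) (Suc n). Suc n \<in> U}"
    and "insert (Suc n) V - {Suc n} = V"
    by (auto simp: k_subsets_def)
qed auto

text \<open>
  The case in which the first car takes another spot \<open>s\<close>: exchange the sums over \<open>U\<close> and \<open>s\<close>, so
  that the set \<open>V = U - {s}\<close> is chosen first and \<open>s\<close> then ranges over its complement.
\<close>

lemma sum_remove_other_spot:
  "(\<Sum>U\<in>{U \<in> k_subsets (Suc k) (Suc n). Suc n \<in> U}. \<Sum>s\<in>U - {Suc n}. f (U - {s})) =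
    (Suc n - k) * (\<Sum>V\<in>{V \<in> k_subsets k (Suc n). Suc n \<in> V}. f V)"
proof -
  let ?A = "{U \<in> k_subsets (Suc k) (Suc n). Suc n \<in> U}"
  let ?B = "{V \<in> k_subsets k (Suc n). Suc n \<in> V}"
  have finite_sets: "finite ?A" "finite ?B" by (auto simp: finite_k_subsets)
  have "(\<Sum>U\<in>?A. \<Sum>s\<in>U - {Suc n}. f (U - {s})) =
      (\<Sum>(U, s)\<in>(SIGMA U:?A. U - {Suc n}). f (U - {s}))"
    by (rule sum.Sigma) (auto simp: finite_k_subsets dest: finite_k_subset)
  also have "\<dots> = (\<Sum>(V, s)\<in>(SIGMA V:?B. {1..Suc n} - V). f V)"
  proof (rule sum.reindex_bij_witness
      [where i = "\<lambda>(V, s). (insert s V, s)" and j = "\<lambda>(U, s). (U - {s}, s)"])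
    fix p assume p: "p \<in> (SIGMA U:?A. U - {Suc n})"
    then have "finite (fst p)" by (auto dest: finite_k_subset)
    with p show "(case p of (U, s) \<Rightarrow> (U - {s}, s)) \<in> (SIGMA V:?B. {1..Suc n} - V)"
      by (auto simp: k_subsets_def)
  next
    fix p assume p: "p \<in> (SIGMA V:?B. {1..Suc n} - V)"
    then have "finite (fst p)" by (auto dest: finite_k_subset)
    with p show "(case p of (V, s) \<Rightarrow> (insert s V, s)) \<in> (SIGMA U:?A. U - {Suc n})"
      by (auto simp: k_subsets_def)
  qed auto
  also have "\<dots> = (\<Sum>V\<in>?B. \<Sum>s\<in>{1..Suc n} - V. f V)"
    by (rule sum.Sigma[symmetric]) (use finite_sets in auto)
  also have "\<dots> = (\<Sum>V\<in>?B. (Suc n - k) * f V)"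
  proof (rule sum.cong[OF refl])
    fix V assume V: "V \<in> ?B"
    then have "card ({1..Suc n} - V) = Suc n - k"
      using finite_k_subset[of V k "Suc n"] by (auto simp: k_subsets_def card_Diff_subset)
    then show "(\<Sum>s\<in>{1..Suc n} - V. f V) = (Suc n - k) * f V" by simp
  qed
  finally show ?thesis by (simp add: sum_distrib_left)
qed

text \<open>
  The two cases for the first car contribute the same factor \<open>n + 1 - k\<close>, the first with the
  \<open>k\<close>-subsets of \<open>{1..n + 1}\<close> that avoid \<open>n + 1\<close>, the second with those that contain it.
\<close>

lemma total_fillings_Suc:
  "total_fillings (Suc k) (Suc n) =
    total_fillings (Suc k) n + (Suc n - k) * total_fillings k (Suc n)"
proof -
  let ?A = "{U \<in> k_subsets (Suc k) (Suc n). Suc n \<in> U}"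
  let ?B = "{V \<in> k_subsets k (Suc n). Suc n \<in> V}"
  have "(\<Sum>U\<in>?A. fillings (Suc k) U) =
      (\<Sum>U\<in>?A. (Suc n - k) * fillings k (U - {Suc n}) +
        (\<Sum>s\<in>U - {Suc n}. fillings k (U - {s})))"
  proof (rule sum.cong[OF refl])
    fix U assume U: "U \<in> ?A"
    then have fin: "finite U" using finite_k_subset by blast
    have Max_U: "Max U = Suc n"
      using U fin by (intro Max_eqI) (auto simp: k_subsets_def)
    show "fillings (Suc k) U = (Suc n - k) * fillings k (U - {Suc n}) +
        (\<Sum>s\<in>U - {Suc n}. fillings k (U - {s}))"
      using U fin by (auto simp: Max_U sum.remove[of U "Suc n"] intro!: sum.cong)
  qed
  also have "\<dots> = (Suc n - k) * (\<Sum>V\<in>k_subsets k n. fillings k V) +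
      (Suc n - k) * (\<Sum>V\<in>?B. fillings k V)"
    by (simp only: sum.distrib sum_distrib_left[symmetric] sum_remove_other_spot
        sum_remove_last_spot)
  also have "\<dots> = (Suc n - k) * total_fillings k (Suc n)"
    by (simp only: total_fillings_def sum_k_subsets_Suc_right[of _ k n] distrib_left)
  finally show ?thesis
    by (simp only: total_fillings_def sum_k_subsets_Suc_right[of _ "Suc k" n])
qed

section \<open>The closed form\<close>

text \<open>
  The difference \<open>d = n - k\<close> is the second parameter because the recurrence relates \<open>(k + 1, d)\<close>
  to \<open>(k + 1, d - 1)\<close> and \<open>(k, d + 1)\<close>, so that an inner induction on \<open>d\<close> suffices.
\<close>

lemma total_fillings_closed_form:
  "2 ^ k * fact k * fact d * total_fillings k (k + d) = (fact (2 * k + d) :: nat)"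
proof (induction k arbitrary: d)
  case 0
  show ?case by (simp add: total_fillings_def k_subsets_0)
next
  case (Suc k)
  note outer_IH = Suc.IH
  show ?case
  proof (induction d)
    case 0
    have "total_fillings (Suc k) k = 0"
      by (simp add: total_fillings_def k_subsets_empty)
    then have rec: "total_fillings (Suc k) (Suc k) = total_fillings k (k + 1)"
      by (simp add: total_fillings_Suc)
    have "2 ^ Suc k * fact (Suc k) * fact 0 * total_fillings (Suc k) (Suc k + 0) =
        2 * Suc k * (2 ^ k * fact k * fact 1 * total_fillings k (k + 1))"
      by (simp add: rec algebra_simps)
    also have "\<dots> = 2 * Suc k * fact (2 * k + 1)" by (simp only: outer_IH)
    also have "\<dots> = fact (2 * Suc k + 0)" by (simp add: algebra_simps)
    finally show ?case .
  next
    case (Suc d)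
    have rec: "total_fillings (Suc k) (Suc k + Suc d) =
        total_fillings (Suc k) (Suc k + d) + (d + 2) * total_fillings k (k + (d + 2))"
      using total_fillings_Suc[of k "Suc k + d"] by (simp add: algebra_simps)
    have "2 ^ Suc k * fact (Suc k) * fact (Suc d) * total_fillings (Suc k) (Suc k + Suc d) =
        Suc d * (2 ^ Suc k * fact (Suc k) * fact d * total_fillings (Suc k) (Suc k + d)) +
        2 * Suc k * (2 ^ k * fact k * fact (d + 2) * total_fillings k (k + (d + 2)))"
      unfolding rec by (simp add: algebra_simps)
    also have "\<dots> = Suc d * fact (2 * Suc k + d) + 2 * Suc k * fact (2 * k + (d + 2))"
      by (simp only: Suc.IH outer_IH)
    also have "\<dots> = fact (2 * Suc k + Suc d)"
      by (simp add: algebra_simps)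
    finally show ?case .
  qed
qed

lemma fact_double_eq_odd_product:
  "fact (2 * n) = 2 ^ n * fact n * (\<Prod>k = 1..n. 2 * k - 1 :: nat)"
proof (induction n)
  case (Suc n)
  have "fact (2 * Suc n) = 2 * Suc n * (2 * Suc n - 1) * (fact (2 * n) :: nat)"
    by (simp add: algebra_simps)
  also have "\<dots> = 2 ^ Suc n * fact (Suc n) * ((\<Prod>k = 1..n. 2 * k - 1) * (2 * Suc n - 1))"
    unfolding Suc.IH fact_Suc power_Suc of_nat_id by (simp only: mult_ac)
  also have "(\<Prod>k = 1..n. 2 * k - 1) * (2 * Suc n - 1) = (\<Prod>k = 1..Suc n. 2 * k - 1)"
    by simp
  finally show ?case .
qed simp

theorem theorem2p18:
  fixes n :: nat
  assumes "n \<ge> 1"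
  shows "card {as. frustrated_parking_function n as} = (\<Prod>k = 1..n. 2 * k - 1)"
proof -
  have "{as. frustrated_parking_function n as} = completions n {1..n}"
    by (auto simp: frustrated_parking_function_def completions_def)
  then have "card {as. frustrated_parking_function n as} = fillings n {1..n}"
    by (simp add: card_completions)
  moreover have "fillings n {1..n} = total_fillings n n"
    by (simp add: total_fillings_def k_subsets_full)
  moreover have "2 ^ n * fact n * total_fillings n n = (fact (2 * n) :: nat)"
    using total_fillings_closed_form[of n 0] by simp
  then have "total_fillings n n = (\<Prod>k = 1..n. 2 * k - 1)"
    by (simp add: fact_double_eq_odd_product)
  ultimately show ?thesis by simp
qed

end
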